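(* Let $G=(V,E)$ be a finite simple graph without isolated vertices, let $\mu$ be the largest eigenvalue of problem (AC), and let $\vec x$ be a corresponding eigenvector. Then the subgraph of $G$ induced by $D_0(\vec x)$ has no edges.
   Context: $V=\{1,\dots,n\}$, unit edge weights, $d_i$ degree, $\mathrm{vol}(V)=\sum_i d_i$. $N(\vec x)=\min_t\sum_i d_i|x_i-t|$. $\mathrm{Sgn}(t)=\{1\},[-1,1],\{-1\}$ for $t>0,t=0,t<0$; $(\Delta_1\vec x)_i=\{\sum_{j:\{i,j\}\in E}z_{ij}: z_{ij}\in\mathrm{Sgn}(x_i-x_j),z_{ij}=-z_{ji}\}$. Problem (AC): $(\mu,\vec x)$ with $\vec x\ne\vec 0$ and $\vec 0\in\Delta_1\vec x-2\mu\,\mathrm{vol}(V)\,\partial\|\vec x\|_\infty+\mu\,\partial N(\vec x)$ ($\partial$ = convex subdifferential). $D_0(\vec x)=\{i:|x_i|<\|\vec x\|_\infty\}$. *)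

theory Defs
  imports "HOL-Analysis.Analysis"
begin

text \<open>A graph has the finite type \<open>'n\<close> as vertex set and is given by its set of edges
  (two-element sets of vertices).\<close>

definition simple_graph :: "'n::finite set set \<Rightarrow> bool" where
  "simple_graph E \<longleftrightarrow> (\<forall>e\<in>E. card e = 2)"

definition isolated_vertex :: "'n::finite set set \<Rightarrow> 'n \<Rightarrow> bool" where
  "isolated_vertex E i \<longleftrightarrow> (\<forall>e\<in>E. i \<notin> e)"

definition neighbours :: "'n::finite set set \<Rightarrow> 'n \<Rightarrow> 'n set" where
  "neighbours E i = {j. {i, j} \<in> E}"

definition vdegree :: "'n::finite set set \<Rightarrow> 'n \<Rightarrow> nat" where
  "vdegree E i = card (neighbours E i)"

definition volume :: "'n::finite set set \<Rightarrow> real" where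
  "volume E = (\<Sum>i\<in>UNIV. real (vdegree E i))"

definition induced_edges :: "'n::finite set set \<Rightarrow> 'n set \<Rightarrow> 'n set set" where
  "induced_edges E S = {e \<in> E. e \<subseteq> S}"

text \<open>The infimum is attained, see \<open>Nfun_is_min\<close>.\<close>

definition Nfun :: "'n::finite set set \<Rightarrow> real ^ 'n \<Rightarrow> real" where
  "Nfun E x = (INF t. \<Sum>i\<in>UNIV. real (vdegree E i) * \<bar>x $ i - t\<bar>)"

lemma Nfun_is_min:
  fixes E :: "'n::finite set set" and x :: "real ^ 'n"
  obtains t where "Nfun E x = (\<Sum>i\<in>UNIV. real (vdegree E i) * \<bar>x $ i - t\<bar>)"
    and "\<And>s. (\<Sum>i\<in>UNIV. real (vdegree E i) * \<bar>x $ i - t\<bar>)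
              \<le> (\<Sum>i\<in>UNIV. real (vdegree E i) * \<bar>x $ i - s\<bar>)"
proof -
  define f where "f t = (\<Sum>i\<in>UNIV. real (vdegree E i) * \<bar>x $ i - t\<bar>)" for t
  define B where "B = norm x"
  have B: "\<bar>x $ i\<bar> \<le> B" for i
    by (simp add: B_def component_le_norm_cart)
  have "B \<ge> 0" by (simp add: B_def)
  have "continuous_on {-B..B} f"
    unfolding f_def by (intro continuous_intros)
  with \<open>B \<ge> 0\<close> obtain t where t: "\<And>s. s \<in> {-B..B} \<Longrightarrow> f t \<le> f s"
    using continuous_attains_inf[of "{-B..B}" f] by fastforce
  have min: "f t \<le> f s" for s
  proof -
    define c where "c = max (-B) (min B s)"
    have "f t \<le> f c"
      using \<open>B \<ge> 0\<close> by (intro t) (auto simp: c_def)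
    also have "f c \<le> f s"
      unfolding f_def
    proof (intro sum_mono mult_left_mono)
      fix i
      show "\<bar>x $ i - c\<bar> \<le> \<bar>x $ i - s\<bar>"
        using B[of i] \<open>B \<ge> 0\<close> unfolding c_def by (auto simp: max_def min_def)
    qed simp
    finally show ?thesis .
  qed
  have "(INF s. f s) = f t"
    by (rule cInf_eq_minimum) (use min in auto)
  then show thesis
    using that[of t] min by (simp add: Nfun_def f_def)
qed

definition Sgn :: "real \<Rightarrow> real set" where
  "Sgn t = (if t > 0 then {1} else if t = 0 then {-1..1} else {-1})"

text \<open>One antisymmetric family \<open>z\<close> serves all components simultaneously, so this is
  a set of vectors that need not be the product of its coordinate projections.\<close>

definition one_Laplacian :: "'n::finite set set \<Rightarrow> real ^ 'n \<Rightarrow> (real ^ 'n) set" where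
  "one_Laplacian E x =
     {(\<chi> i. \<Sum>j\<in>neighbours E i. z i j) | z :: 'n \<Rightarrow> 'n \<Rightarrow> real.
        \<forall>i j. {i, j} \<in> E \<longrightarrow> z i j \<in> Sgn (x $ i - x $ j) \<and> z i j = - z j i}"

definition subdifferential :: "('a::real_inner \<Rightarrow> real) \<Rightarrow> 'a \<Rightarrow> 'a set" where
  "subdifferential f x = {g. \<forall>y. f y \<ge> f x + g \<bullet> (y - x)}"

text \<open>Sums and scalar multiples of sets in the inclusion defining (AC) are in the Minkowski
  sense.\<close>

definition AC_eigenpair :: "'n::finite set set \<Rightarrow> real \<Rightarrow> real ^ 'n \<Rightarrow> bool" where
  "AC_eigenpair E \<mu> x \<longleftrightarrow> x \<noteq> 0 \<and>
     0 \<in> {a - (2 * \<mu> * volume E) *\<^sub>R b + \<mu> *\<^sub>R c | a b c.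
            a \<in> one_Laplacian E x \<and> b \<in> subdifferential infnorm x \<and>
            c \<in> subdifferential (Nfun E) x}"

definition AC_eigenvalue :: "'n::finite set set \<Rightarrow> real \<Rightarrow> bool" where
  "AC_eigenvalue E \<mu> \<longleftrightarrow> (\<exists>x. AC_eigenpair E \<mu> x)"

definition largest_AC_eigenvalue :: "'n::finite set set \<Rightarrow> real \<Rightarrow> bool" where
  "largest_AC_eigenvalue E \<mu> \<longleftrightarrow> AC_eigenvalue E \<mu> \<and> (\<forall>\<nu>. AC_eigenvalue E \<nu> \<longrightarrow> \<nu> \<le> \<mu>)"

definition D0 :: "real ^ 'n::finite \<Rightarrow> 'n set" where
  "D0 x = {i. \<bar>x $ i\<bar> < infnorm x}"

end

theory Submission
  imports Defs
begin

text \<open>Pairing (AC) with \<open>x\<close> and using homogeneity shows that every eigenvalue is a value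
  of the quotient \<open>I(x) / (2 vol(V) \<parallel>x\<parallel> - N(x))\<close>, where \<open>I\<close> is the total variation and
  \<open>\<parallel>x\<parallel>\<close> the maximum norm.  Conversely a maximiser of the quotient is an eigenvector: if
  \<open>m\<close> is the maximum, then \<open>I + m N \<le> 2 m vol(V) \<parallel>\<cdot>\<parallel>\<close> with equality at the maximiser, so subgradients
  of the left-hand side there are subgradients of the right-hand side.  Hence eigenvectors of the
  largest eigenvalue are maximisers.  If an edge \<open>{i, j}\<close> joined two vertices of \<open>D\<^sub>0(x)\<close>,
  then \<open>x\<close> would be a proper convex combination of the two vectors obtained by moving the \<open>i\<close>-th
  entry to \<open>\<plusminus>\<parallel>x\<parallel>\<close>.  This does not increase the norm, but \<open>\<bar>x\<^sub>i - x\<^sub>j\<bar>\<close> is strictly convex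
  along it because of its kink at \<open>x\<^sub>j\<close>, contradicting maximality.\<close>

subsection \<open>Subgradients\<close>

text \<open>A hyperplane separates the origin from the strict epigraph of \<open>f\<close>, shifted
  so that the graph point at \<open>x\<close> becomes 0. Its normal \<open>(g, \<alpha>)\<close> has
  \<open>\<alpha> > 0\<close> because \<open>f\<close> is finite everywhere, so
  \<open>- g / \<alpha>\<close> is a subgradient.\<close>

lemma subdifferential_nonempty:
  fixes f :: "'a::euclidean_space \<Rightarrow> real"
  assumes "convex_on UNIV f"
  shows "subdifferential f x \<noteq> {}"
proof -
  define S where "S = {p :: 'a \<times> real. f (x + fst p) < f x + snd p}"
  have "convex S"
    unfolding convex_alt
  proof (intro ballI allI impI)
    fix p q :: "'a \<times> real" and u :: real
    assume p: "p \<in> S" and q: "q \<in> S" and u: "0 \<le> u \<and> u \<le> 1"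
    have "x + fst ((1 - u) *\<^sub>R p + u *\<^sub>R q) = (1 - u) *\<^sub>R (x + fst p) + u *\<^sub>R (x + fst q)"
      by (simp add: algebra_simps)
    then have "f (x + fst ((1 - u) *\<^sub>R p + u *\<^sub>R q))
        \<le> (1 - u) * f (x + fst p) + u * f (x + fst q)"
      using convex_onD[OF assms, of u "x + fst p" "x + fst q"] u by simp
    also have "\<dots> < (1 - u) * (f x + snd p) + u * (f x + snd q)"
    \<comment> \<open>Strictness comes from \<open>p\<close> if \<open>u = 0\<close>, and from
      \<open>q\<close> otherwise.\<close>
    proof (cases "u = 0")
      case True
      then show ?thesis using p by (simp add: S_def)
    next
      case False
      then show ?thesis
        using p q u by (intro add_le_less_mono mult_left_mono mult_strict_left_mono)
          (auto simp: S_def)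
    qed
    finally show "(1 - u) *\<^sub>R p + u *\<^sub>R q \<in> S"
      by (simp add: S_def algebra_simps)
  qed
  moreover have "0 \<notin> S" by (simp add: S_def)
  ultimately obtain w where w: "w \<noteq> 0" and wS: "\<And>p. p \<in> S \<Longrightarrow> 0 \<le> w \<bullet> p"
    using separating_hyperplane_set_0 by blast
  obtain g \<alpha> where w_eq: "w = (g, \<alpha>)" by (cases w)
  have sep: "0 \<le> g \<bullet> y + \<alpha> * r" if "f (x + y) < f x + r" for y r
    using wS[of "(y, r)"] that by (simp add: S_def w_eq)
  have "0 \<le> \<alpha>" using sep[of 0 1] by simp
  have "\<alpha> \<noteq> 0"
  proof
    assume "\<alpha> = 0"
    \<comment> \<open>A vertical hyperplane ignores height, so a large enough height puts the
      direction \<open>- g\<close> into \<open>S\<close>.\<close>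
    then have "0 \<le> g \<bullet> (- g)"
      using sep[of "- g" "f (x - g) - f x + 1"] by simp
    then have "g = 0" by (simp add: inner_gt_zero_iff flip: not_less)
    with \<open>\<alpha> = 0\<close> w show False by (simp add: w_eq zero_prod_def)
  qed
  with \<open>0 \<le> \<alpha>\<close> have "0 < \<alpha>" by simp
  have "f y \<ge> f x + (- (1 / \<alpha>) *\<^sub>R g) \<bullet> (y - x)" for y
  \<comment> \<open>Membership in \<open>S\<close> is strict, hence the slack
    \<open>e\<close>.\<close>
  proof (rule field_le_epsilon)
    fix e :: real
    assume "0 < e"
    then have "0 \<le> g \<bullet> (y - x) + \<alpha> * (f y - f x + e)"
      by (intro sep) simp
    then show "f x + (- (1 / \<alpha>) *\<^sub>R g) \<bullet> (y - x) \<le> f y + e"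
      using \<open>0 < \<alpha>\<close> by (simp add: field_simps)
  qed
  then show ?thesis unfolding subdifferential_def by blast
qed

text \<open>Euler's identity: testing the subgradient inequality at 0 and at
  \<open>2 *\<^sub>R x\<close> gives the two opposite bounds.\<close>

lemma subgradient_inner_self:
  assumes "g \<in> subdifferential f x"
    and "\<And>c. 0 \<le> c \<Longrightarrow> f (c *\<^sub>R x) = c * f x"
  shows "g \<bullet> x = f x"
proof -
  have sub: "f y \<ge> f x + g \<bullet> (y - x)" for y
    using assms(1) by (simp add: subdifferential_def)
  show ?thesis
    using sub[of "0 *\<^sub>R x"] sub[of "2 *\<^sub>R x"] assms(2)[of 0] assms(2)[of 2]
    by (simp add: algebra_simps)
qed

subsection \<open>The function \<open>N\<close>\<close>

lemma Nfun_le: "Nfun E x \<le> (\<Sum>i\<in>UNIV. real (vdegree E i) * \<bar>x $ i - t\<bar>)"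
  using Nfun_is_min[of E x] by metis

text \<open>The sum is jointly convex in the vector and the shift, so combining the optimal shifts
  for \<open>x\<close> and \<open>y\<close> gives a good enough shift for the combined
  vector.\<close>

lemma convex_on_Nfun: "convex_on UNIV (Nfun E)"
proof (rule convex_onI)
  fix u :: real and x y :: "real ^ 'a"
  assume u: "0 < u" "u < 1"
  let ?d = "\<lambda>i. real (vdegree E i)"
  obtain t where t: "Nfun E x = (\<Sum>i\<in>UNIV. ?d i * \<bar>x $ i - t\<bar>)"
    using Nfun_is_min by blast
  obtain s where s: "Nfun E y = (\<Sum>i\<in>UNIV. ?d i * \<bar>y $ i - s\<bar>)"
    using Nfun_is_min by blast
  have "Nfun E ((1 - u) *\<^sub>R x + u *\<^sub>R y)
      \<le> (\<Sum>i\<in>UNIV. ?d i * \<bar>((1 - u) *\<^sub>R x + u *\<^sub>R y) $ i - ((1 - u) * t + u * s)\<bar>)"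
    by (rule Nfun_le)
  also have "\<dots> \<le> (\<Sum>i\<in>UNIV. ?d i * ((1 - u) * \<bar>x $ i - t\<bar> + u * \<bar>y $ i - s\<bar>))"
  proof (intro sum_mono mult_left_mono)
    fix i
    have "((1 - u) *\<^sub>R x + u *\<^sub>R y) $ i - ((1 - u) * t + u * s)
        = (1 - u) * (x $ i - t) + u * (y $ i - s)"
      by (simp add: algebra_simps)
    also have "\<bar>\<dots>\<bar> \<le> (1 - u) * \<bar>x $ i - t\<bar> + u * \<bar>y $ i - s\<bar>"
      using u abs_triangle_ineq[of "(1 - u) * (x $ i - t)" "u * (y $ i - s)"]
      by (simp add: abs_mult)
    finally show "\<bar>((1 - u) *\<^sub>R x + u *\<^sub>R y) $ i - ((1 - u) * t + u * s)\<bar>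
        \<le> (1 - u) * \<bar>x $ i - t\<bar> + u * \<bar>y $ i - s\<bar>" .
  qed simp
  also have "\<dots> = (1 - u) * Nfun E x + u * Nfun E y"
    unfolding t s by (simp add: sum_distrib_left sum.distrib distrib_left mult.left_commute)
  finally show "Nfun E ((1 - u) *\<^sub>R x + u *\<^sub>R y) \<le> (1 - u) * Nfun E x + u * Nfun E y" .
qed simp

lemma Nfun_nonneg: "0 \<le> Nfun E x"
proof -
  obtain t where "Nfun E x = (\<Sum>i\<in>UNIV. real (vdegree E i) * \<bar>x $ i - t\<bar>)"
    using Nfun_is_min by blast
  then show ?thesis by (simp add: sum_nonneg)
qed

lemma Nfun_scaleR_le:
  assumes "0 \<le> c"
  shows "Nfun E (c *\<^sub>R x) \<le> c * Nfun E x"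
proof -
  obtain t where t: "Nfun E x = (\<Sum>i\<in>UNIV. real (vdegree E i) * \<bar>x $ i - t\<bar>)"
    using Nfun_is_min by blast
  have "\<bar>(c *\<^sub>R x) $ i - c * t\<bar> = c * \<bar>x $ i - t\<bar>" for i
    using assms by (simp add: abs_mult flip: right_diff_distrib)
  then show ?thesis
    using Nfun_le[of E "c *\<^sub>R x" "c * t"]
    by (simp add: t sum_distrib_left algebra_simps)
qed

lemma Nfun_scaleR:
  assumes "0 \<le> c"
  shows "Nfun E (c *\<^sub>R x) = c * Nfun E x"
proof (cases "c = 0")
  case True
  then show ?thesis
    using Nfun_scaleR_le[OF assms, of E x] Nfun_nonneg[of E "c *\<^sub>R x"] by simp
next
  case False
  with assms have "0 < c" by simp
  \<comment> \<open>The reverse inequality is the same bound, applied to scaling back by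
    \<open>1 / c\<close>.\<close>
  then have "Nfun E x \<le> (1 / c) * Nfun E (c *\<^sub>R x)"
    using Nfun_scaleR_le[of "1 / c" E "c *\<^sub>R x"] by simp
  then show ?thesis
    using \<open>0 < c\<close> Nfun_scaleR_le[OF assms, of E x] by (simp add: field_simps)
qed

section \<open>The maximum norm in coordinates and its comparison with \<open>Nfun\<close>\<close>

lemma component_le_infnorm: "\<bar>x $ i\<bar> \<le> infnorm (x :: real ^ 'n::finite)"
  using Basis_le_infnorm[of "axis i 1" x] by (simp add: cart_eq_inner_axis axis_in_Basis_iff)

lemma infnorm_le_iff: "infnorm (x :: real ^ 'n::finite) \<le> B \<longleftrightarrow> (\<forall>i. \<bar>x $ i\<bar> \<le> B)"
proof -
  have "{\<bar>x \<bullet> b\<bar> | b. b \<in> Basis} = range (\<lambda>i. \<bar>x $ i\<bar>)"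
    by (auto simp: Basis_vec_def cart_eq_inner_axis)
  then have "infnorm x = Max (range (\<lambda>i. \<bar>x $ i\<bar>))"
    unfolding infnorm_def by (simp add: cSup_eq_Max)
  then show ?thesis by simp
qed

lemma Nfun_le_volume: "Nfun E x \<le> volume E * infnorm x"
proof -
  have "Nfun E x \<le> (\<Sum>i\<in>UNIV. real (vdegree E i) * \<bar>x $ i\<bar>)"
    using Nfun_le[of E x 0] by simp
  also have "\<dots> \<le> volume E * infnorm x"
    unfolding volume_def sum_distrib_right
    by (intro sum_mono mult_left_mono component_le_infnorm) simp
  finally show ?thesis .
qed

subsection \<open>Total variation and the 1-Laplacian\<close>

text \<open>Both orientations are kept to match the indexing of \<open>z i j\<close> and to make
  swapping endpoints a symmetry of sums.\<close>

definition arcs :: "'n::finite set set \<Rightarrow> ('n \<times> 'n) set" where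
  "arcs E = {(i, j). {i, j} \<in> E}"

text \<open>Every edge gives two arcs, hence the factor \<open>1/2\<close>.\<close>

definition total_variation :: "'n::finite set set \<Rightarrow> real ^ 'n \<Rightarrow> real" where
  "total_variation E x = (\<Sum>(i, j)\<in>arcs E. \<bar>x $ i - x $ j\<bar>) / 2"

lemma sum_arcs_swap: "(\<Sum>(i, j)\<in>arcs E. f i j) = (\<Sum>(i, j)\<in>arcs E. f j i)"
  by (rule sum.reindex_bij_witness[of _ prod.swap prod.swap])
    (auto simp: arcs_def insert_commute)

lemma total_variation_scaleR:
  "total_variation E (c *\<^sub>R x) = \<bar>c\<bar> * total_variation E x"
  by (simp add: total_variation_def sum_distrib_left case_prod_unfold
      flip: right_diff_distrib abs_mult)

lemma continuous_on_total_variation: "continuous_on S (total_variation E)"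
  unfolding total_variation_def case_prod_unfold by (intro continuous_intros) auto

text \<open>Summation by parts: the double sum for \<open>a \<bullet> y\<close> is averaged with its
  copy under the swap of endpoints, where antisymmetry of \<open>z\<close> turns
  \<open>z j i\<close> into \<open>- z i j\<close>.\<close>

lemma inner_one_LaplacianE:
  assumes "a \<in> one_Laplacian E x"
  obtains z where "\<And>i j. (i, j) \<in> arcs E \<Longrightarrow> z i j \<in> Sgn (x $ i - x $ j)"
    and "\<And>y. a \<bullet> y = (\<Sum>(i, j)\<in>arcs E. z i j * (y $ i - y $ j)) / 2"
proof -
  obtain z where a: "a = (\<chi> i. \<Sum>j\<in>neighbours E i. z i j)"
    and z: "\<And>i j. {i, j} \<in> E \<Longrightarrow> z i j \<in> Sgn (x $ i - x $ j) \<and> z i j = - z j i"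
    using assms unfolding one_Laplacian_def by blast
  have arcs: "arcs E = Sigma UNIV (neighbours E)"
    by (auto simp: arcs_def neighbours_def)
  have "a \<bullet> y = (\<Sum>(i, j)\<in>arcs E. z i j * (y $ i - y $ j)) / 2" for y
  proof -
    have "a \<bullet> y = (\<Sum>i\<in>UNIV. \<Sum>j\<in>neighbours E i. z i j * y $ i)"
      by (simp add: a inner_vec_def sum_distrib_right)
    also have "\<dots> = (\<Sum>(i, j)\<in>arcs E. z i j * y $ i)"
      unfolding arcs by (rule sum.Sigma) auto
    finally have 1: "a \<bullet> y = (\<Sum>(i, j)\<in>arcs E. z i j * y $ i)" .
    also have "\<dots> = (\<Sum>(i, j)\<in>arcs E. z j i * y $ j)"
      by (rule sum_arcs_swap)
    also have "\<dots> = (\<Sum>(i, j)\<in>arcs E. - (z i j * y $ j))"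
    proof (rule sum.cong[OF refl], clarify)
      fix i j assume "(i, j) \<in> arcs E"
      then have "z i j = - z j i" using z by (simp add: arcs_def)
      then show "z j i * y $ j = - (z i j * y $ j)" by simp
    qed
    finally have 2: "a \<bullet> y = (\<Sum>(i, j)\<in>arcs E. - (z i j * y $ j))" .
    have "2 * (a \<bullet> y) = (\<Sum>(i, j)\<in>arcs E. z i j * y $ i) + (\<Sum>(i, j)\<in>arcs E. - (z i j * y $ j))"
      using 1 2 by simp
    also have "\<dots> = (\<Sum>(i, j)\<in>arcs E. z i j * (y $ i - y $ j))"
      by (simp add: case_prod_unfold right_diff_distrib flip: sum.distrib)
    finally show ?thesis by simp
  qed
  with z show thesis using that[of z] unfolding arcs_def by blast
qed

lemma inner_one_Laplacian_self:
  assumes "a \<in> one_Laplacian E x"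
  shows "a \<bullet> x = total_variation E x"
proof -
  obtain z where z: "\<And>i j. (i, j) \<in> arcs E \<Longrightarrow> z i j \<in> Sgn (x $ i - x $ j)"
    and a: "\<And>y. a \<bullet> y = (\<Sum>(i, j)\<in>arcs E. z i j * (y $ i - y $ j)) / 2"
    using inner_one_LaplacianE[OF assms] by blast
  have "z i j * (x $ i - x $ j) = \<bar>x $ i - x $ j\<bar>" if "(i, j) \<in> arcs E" for i j
    using z[OF that] by (auto simp: Sgn_def split: if_splits)
  then show ?thesis
    unfolding a total_variation_def by (simp add: case_prod_unfold)
qed

text \<open>All values in \<open>Sgn\<close> have modulus at most 1. Together with equality at
  \<open>x\<close>, this makes \<open>a\<close> a subgradient of the total variation at
  \<open>x\<close>.\<close>

lemma inner_one_Laplacian_le: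
  assumes "a \<in> one_Laplacian E x"
  shows "a \<bullet> y \<le> total_variation E y"
proof -
  obtain z where z: "\<And>i j. (i, j) \<in> arcs E \<Longrightarrow> z i j \<in> Sgn (x $ i - x $ j)"
    and a: "\<And>y. a \<bullet> y = (\<Sum>(i, j)\<in>arcs E. z i j * (y $ i - y $ j)) / 2"
    using inner_one_LaplacianE[OF assms] by blast
  have "z i j * (y $ i - y $ j) \<le> \<bar>y $ i - y $ j\<bar>" if "(i, j) \<in> arcs E" for i j
  proof -
    have "\<bar>z i j\<bar> \<le> 1"
      using z[OF that] by (auto simp: Sgn_def split: if_splits)
    then have "\<bar>z i j * (y $ i - y $ j)\<bar> \<le> 1 * \<bar>y $ i - y $ j\<bar>"
      unfolding abs_mult by (intro mult_right_mono) auto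
    then show ?thesis by simp
  qed
  then show ?thesis
    unfolding a total_variation_def by (auto intro!: divide_right_mono sum_mono)
qed

lemma one_Laplacian_nonempty: "one_Laplacian E x \<noteq> {}"
proof -
  have "sgn (x $ i - x $ j) \<in> Sgn (x $ i - x $ j) \<and> sgn (x $ i - x $ j) = - sgn (x $ j - x $ i)"
    for i j
    by (auto simp: Sgn_def sgn_if)
  then have "(\<chi> i. \<Sum>j\<in>neighbours E i. sgn (x $ i - x $ j)) \<in> one_Laplacian E x"
    unfolding one_Laplacian_def
    by (intro CollectI exI[of _ "\<lambda>i j. sgn (x $ i - x $ j)"]) blast
  then show ?thesis by blast
qed

text \<open>Strictness comes from the arc \<open>(i, j)\<close>: a convex combination of numbers of opposite
  signs.\<close>

lemma total_variation_strictly_convex_across: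
  assumes "{i, j} \<in> E" "0 < u" "u < 1"
    and "y $ i < y $ j" "z $ j < z $ i"
  shows "total_variation E ((1 - u) *\<^sub>R y + u *\<^sub>R z)
    < (1 - u) * total_variation E y + u * total_variation E z"
proof -
  let ?x = "(1 - u) *\<^sub>R y + u *\<^sub>R z"
  have split: "?x $ k - ?x $ l = (1 - u) * (y $ k - y $ l) + u * (z $ k - z $ l)" for k l
    by (simp add: algebra_simps)
  have le: "\<bar>?x $ k - ?x $ l\<bar> \<le> (1 - u) * \<bar>y $ k - y $ l\<bar> + u * \<bar>z $ k - z $ l\<bar>" for k l
    unfolding split
    using assms(2,3) abs_triangle_ineq[of "(1 - u) * (y $ k - y $ l)" "u * (z $ k - z $ l)"]
    by (simp add: abs_mult)
  have "(1 - u) * (y $ i - y $ j) < 0" "0 < u * (z $ i - z $ j)"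
    using assms by (auto simp: mult_less_0_iff)
  then have "\<bar>(1 - u) * (y $ i - y $ j) + u * (z $ i - z $ j)\<bar>
      < \<bar>(1 - u) * (y $ i - y $ j)\<bar> + \<bar>u * (z $ i - z $ j)\<bar>"
    by linarith
  then have less: "\<bar>?x $ i - ?x $ j\<bar> < (1 - u) * \<bar>y $ i - y $ j\<bar> + u * \<bar>z $ i - z $ j\<bar>"
    unfolding split using assms(2,3) by (simp add: abs_mult)
  have "(\<Sum>(k, l)\<in>arcs E. \<bar>?x $ k - ?x $ l\<bar>)
      < (\<Sum>(k, l)\<in>arcs E. (1 - u) * \<bar>y $ k - y $ l\<bar> + u * \<bar>z $ k - z $ l\<bar>)"
  proof (rule sum_strict_mono_ex1)
    show "\<forall>p\<in>arcs E. (case p of (k, l) \<Rightarrow> \<bar>?x $ k - ?x $ l\<bar>)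
        \<le> (case p of (k, l) \<Rightarrow> (1 - u) * \<bar>y $ k - y $ l\<bar> + u * \<bar>z $ k - z $ l\<bar>)"
      using le by auto
    show "\<exists>p\<in>arcs E. (case p of (k, l) \<Rightarrow> \<bar>?x $ k - ?x $ l\<bar>)
        < (case p of (k, l) \<Rightarrow> (1 - u) * \<bar>y $ k - y $ l\<bar> + u * \<bar>z $ k - z $ l\<bar>)"
      using less assms(1) by (intro bexI[of _ "(i, j)"]) (auto simp: arcs_def)
  qed simp
  also have "\<dots> = (1 - u) * (\<Sum>(k, l)\<in>arcs E. \<bar>y $ k - y $ l\<bar>)
      + u * (\<Sum>(k, l)\<in>arcs E. \<bar>z $ k - z $ l\<bar>)"
    by (simp add: case_prod_unfold sum.distrib sum_distrib_left)
  finally show ?thesis by (simp add: total_variation_def)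
qed

subsection \<open>Variational characterisation of the largest eigenvalue\<close>

lemma volume_pos:
  assumes "\<And>i. \<not> isolated_vertex E i" "simple_graph E"
  shows "0 < volume E"
proof -
  have "0 < real (vdegree E i)" for i
  proof -
    obtain e where e: "e \<in> E" "i \<in> e"
      using assms(1)[of i] by (auto simp: isolated_vertex_def)
    then have "card e = 2" using assms(2) by (simp add: simple_graph_def)
    with e(2) obtain j where "e = {i, j}"
      by (metis card_2_iff insert_commute insertE singletonD)
    with e show ?thesis
      by (auto simp: vdegree_def neighbours_def card_gt_0_iff)
  qed
  then show ?thesis unfolding volume_def by (intro sum_pos) auto
qed

lemma AC_denominator_pos:
  assumes "0 < volume E" "x \<noteq> 0"
  shows "0 < 2 * volume E * infnorm x - Nfun E x"
proof -
  have "0 < volume E * infnorm x"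
    using assms by (simp add: infnorm_pos_lt)
  then show ?thesis using Nfun_le_volume[of E x] by simp
qed

lemma AC_eigenpair_total_variation:
  assumes "AC_eigenpair E \<nu> x"
  shows "total_variation E x = \<nu> * (2 * volume E * infnorm x - Nfun E x)"
proof -
  obtain a b c where abc: "0 = a - (2 * \<nu> * volume E) *\<^sub>R b + \<nu> *\<^sub>R c"
    and a: "a \<in> one_Laplacian E x" and b: "b \<in> subdifferential infnorm x"
    and c: "c \<in> subdifferential (Nfun E) x"
    using assms unfolding AC_eigenpair_def by blast
  have "b \<bullet> x = infnorm x"
    using b by (rule subgradient_inner_self) (simp add: infnorm_mul)
  moreover have "c \<bullet> x = Nfun E x"
    using c by (rule subgradient_inner_self) (rule Nfun_scaleR)
  moreover have "a \<bullet> x = total_variation E x"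
    using a by (rule inner_one_Laplacian_self)
  moreover have "0 = (a - (2 * \<nu> * volume E) *\<^sub>R b + \<nu> *\<^sub>R c) \<bullet> x"
    using abc by simp
  ultimately show ?thesis
    by (simp add: inner_add_left inner_diff_left algebra_simps)
qed

lemma maximiser_AC_eigenpair:
  assumes "0 < m" "0 < volume E" "x \<noteq> 0"
    and le: "\<And>y. total_variation E y \<le> m * (2 * volume E * infnorm y - Nfun E y)"
    and eq: "total_variation E x = m * (2 * volume E * infnorm x - Nfun E x)"
  shows "AC_eigenpair E m x"
proof -
  obtain a where a: "a \<in> one_Laplacian E x"
    using one_Laplacian_nonempty by blast
  obtain c where c: "c \<in> subdifferential (Nfun E) x"
    using subdifferential_nonempty[OF convex_on_Nfun] by blast
  define k where "k = 2 * m * volume E"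
  have "0 < k" using assms by (simp add: k_def)
  \<comment> \<open>The inclusion in (AC) forces this \<open>b\<close>; what remains is that it is a
    subgradient of the maximum norm.\<close>
  define b where "b = (1 / k) *\<^sub>R (a + m *\<^sub>R c)"
  have "infnorm y \<ge> infnorm x + b \<bullet> (y - x)" for y
  proof -
    have "a \<bullet> (y - x) \<le> total_variation E y - total_variation E x"
      using inner_one_Laplacian_le[OF a, of y] inner_one_Laplacian_self[OF a]
      by (simp add: inner_diff_right)
    moreover have "m * (c \<bullet> (y - x)) \<le> m * (Nfun E y - Nfun E x)"
      using c assms(1) by (intro mult_left_mono) (auto simp: subdifferential_def algebra_simps)
    ultimately have "(a + m *\<^sub>R c) \<bullet> (y - x) \<le> k * (infnorm y - infnorm x)"
      using le[of y] eq by (simp add: k_def inner_add_left algebra_simps)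
    then have "b \<bullet> (y - x) \<le> infnorm y - infnorm x"
      using \<open>0 < k\<close> unfolding b_def inner_scaleR_left by (simp add: field_simps)
    then show ?thesis by simp
  qed
  then have b: "b \<in> subdifferential infnorm x"
    by (simp add: subdifferential_def)
  have "0 = a - (2 * m * volume E) *\<^sub>R b + m *\<^sub>R c"
    using \<open>0 < k\<close> by (simp add: b_def flip: k_def)
  with a b c assms(3) show ?thesis
    unfolding AC_eigenpair_def by blast
qed

text \<open>The quotient is continuous on the compact unit sphere, and homogeneity carries the bound
  to all vectors. The product form also covers \<open>y = 0\<close>.\<close>

lemma exists_maximiser:
  fixes E :: "'n::finite set set"
  assumes "0 < volume E"
  obtains m and x :: "real ^ 'n" where "x \<noteq> 0"
    and "\<And>y. total_variation E y \<le> m * (2 * volume E * infnorm y - Nfun E y)"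
    and "total_variation E x = m * (2 * volume E * infnorm x - Nfun E x)"
proof -
  define den :: "real ^ 'n \<Rightarrow> real"
    where "den y = 2 * volume E * infnorm y - Nfun E y" for y
  have den_pos: "0 < den y" if "y \<noteq> 0" for y
    unfolding den_def using AC_denominator_pos[OF assms that] .
  have den_scale: "den (c *\<^sub>R y) = c * den y" if "0 \<le> c" for c y
    using that by (simp add: den_def infnorm_mul Nfun_scaleR algebra_simps)
  have cont: "continuous_on (sphere 0 1) (\<lambda>y. total_variation E y / den y)"
  proof (intro continuous_on_divide continuous_on_total_variation ballI)
    have "continuous_on UNIV (Nfun E)"
      by (rule convex_on_continuous) (auto intro: convex_on_Nfun)
    then show "continuous_on (sphere 0 1) den"
      unfolding den_def
      by (intro continuous_intros continuous_on_infnorm) (auto intro: continuous_on_subset)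
    show "den y \<noteq> 0" if "y \<in> sphere 0 1" for y
      using den_pos[of y] that by fastforce
  qed
  obtain x :: "real ^ 'n" where x: "x \<in> sphere 0 1"
    and max: "\<And>y. y \<in> sphere 0 1 \<Longrightarrow> total_variation E y / den y \<le> total_variation E x / den x"
    using continuous_attains_sup[OF compact_sphere _ cont] by auto
  define m where "m = total_variation E x / den x"
  have "x \<noteq> 0" using x by auto
  have "total_variation E y \<le> m * den y" for y
  proof (cases "y = 0")
    case True
    then show ?thesis
      using total_variation_scaleR[of E 0 0] den_scale[of 0 0] by simp
  next
    case False
    let ?u = "(1 / norm y) *\<^sub>R y"
    have "?u \<in> sphere 0 1" "?u \<noteq> 0" using False by auto
    then have "total_variation E ?u \<le> m * den ?u"
      using max[of ?u] den_pos[of ?u] by (simp add: m_def field_simps)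
    then show ?thesis
      using False den_scale[of "1 / norm y" y] total_variation_scaleR[of E "1 / norm y" y]
      by (simp add: field_simps)
  qed
  moreover have "total_variation E x = m * den x"
    using den_pos[OF \<open>x \<noteq> 0\<close>] by (simp add: m_def)
  ultimately show thesis
    using that[OF \<open>x \<noteq> 0\<close>] unfolding den_def by blast
qed

text \<open>A test vector showing that the maximum of the quotient is positive once there is an
  edge.\<close>

lemma total_variation_axis_pos:
  assumes "{i, j} \<in> E" "i \<noteq> j"
  shows "0 < total_variation E (axis i 1)"
proof -
  have "0 < (\<Sum>(k, l)\<in>arcs E. \<bar>(axis i (1::real)) $ k - axis i 1 $ l\<bar>)"
    by (rule sum_pos2[of _ "(i, j)"]) (use assms in \<open>auto simp: arcs_def axis_def\<close>)
  then show ?thesis by (simp add: total_variation_def)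
qed

text \<open>The maximum \<open>m\<close> of the quotient is itself an eigenvalue, hence at most
  \<open>\<mu>\<close>; since the denominator is nonnegative, the bound with \<open>m\<close> passes
  to \<open>\<mu>\<close>.\<close>

lemma largest_AC_eigenvalue_bound:
  fixes E :: "'n::finite set set"
  assumes "0 < volume E" "{i, j} \<in> E" "i \<noteq> j" "largest_AC_eigenvalue E \<mu>"
  shows "0 < \<mu>" and "total_variation E y \<le> \<mu> * (2 * volume E * infnorm y - Nfun E y)"
proof -
  obtain m and x :: "real ^ 'n" where x: "x \<noteq> 0"
    and le: "\<And>y. total_variation E y \<le> m * (2 * volume E * infnorm y - Nfun E y)"
    and eq: "total_variation E x = m * (2 * volume E * infnorm x - Nfun E x)"
    using exists_maximiser[OF assms(1)] by metis
  have "0 < m * (2 * volume E * infnorm (axis i 1 :: real ^ 'n) - Nfun E (axis i 1))"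
    using le[of "axis i 1"] total_variation_axis_pos[OF assms(2,3)] by linarith
  moreover have "0 < 2 * volume E * infnorm (axis i 1 :: real ^ 'n) - Nfun E (axis i 1)"
    using assms(1) by (rule AC_denominator_pos) (simp add: axis_eq_0_iff)
  ultimately have "0 < m" by (simp add: zero_less_mult_iff)
  then have "AC_eigenpair E m x"
    using maximiser_AC_eigenpair assms(1) x le eq by blast
  then have "m \<le> \<mu>"
    using assms(4) by (auto simp: largest_AC_eigenvalue_def AC_eigenvalue_def)
  with \<open>0 < m\<close> show "0 < \<mu>" by simp
  have "0 \<le> 2 * volume E * infnorm y - Nfun E y"
    using assms(1) Nfun_le_volume[of E y] mult_nonneg_nonneg[of "volume E" "infnorm y"]
      infnorm_pos_le[of y] by linarith
  then show "total_variation E y \<le> \<mu> * (2 * volume E * infnorm y - Nfun E y)"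
    using le[of y] mult_right_mono[OF \<open>m \<le> \<mu>\<close>] by (meson order_trans)
qed

section \<open>Moving one endpoint of an edge inside \<open>D0 x\<close>\<close>

theorem theorem5p7:
  fixes E :: "'n::finite set set" and \<mu> :: real and x :: "real ^ 'n"
  assumes "simple_graph E"
    and "\<And>i. \<not> isolated_vertex E i"
    and "largest_AC_eigenvalue E \<mu>"
    and "AC_eigenpair E \<mu> x"
  shows "induced_edges E (D0 x) = {}"
proof (rule ccontr)
  assume "induced_edges E (D0 x) \<noteq> {}"
  then obtain e where e: "e \<in> E" "e \<subseteq> D0 x"
    by (auto simp: induced_edges_def)
  then have "card e = 2" using assms(1) by (simp add: simple_graph_def)
  then obtain i j where ij: "e = {i, j}" "i \<noteq> j" by (auto simp: card_2_iff)
  define M where "M = infnorm x"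
  have edge: "{i, j} \<in> E" and xi: "\<bar>x $ i\<bar> < M" and xj: "\<bar>x $ j\<bar> < M"
    using e ij by (auto simp: D0_def M_def)
  have vol: "0 < volume E" using volume_pos assms(1,2) by blast
  note pos = largest_AC_eigenvalue_bound(1)[OF vol edge ij(2) assms(3)]
  note bound = largest_AC_eigenvalue_bound(2)[OF vol edge ij(2) assms(3)]
  define y z :: "real ^ 'n" where "y = (\<chi> k. if k = i then - M else x $ k)"
    and "z = (\<chi> k. if k = i then M else x $ k)"
  have "infnorm y \<le> M" "infnorm z \<le> M"
    using xi component_le_infnorm[of x] by (auto simp: infnorm_le_iff y_def z_def M_def)
  \<comment> \<open>The solution of \<open>(1 - u) * (- M) + u * M = x $ i\<close>; it lies strictly
    between 0 and 1 because \<open>i\<close> is in \<open>D0 x\<close>.\<close>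
  define u where "u = (x $ i + M) / (2 * M)"
  have u: "0 < u" "u < 1"
    using xi by (auto simp: u_def field_simps)
  have x_eq: "x = (1 - u) *\<^sub>R y + u *\<^sub>R z"
    using xi by (auto simp: vec_eq_iff y_def z_def u_def field_simps)
  \<comment> \<open>An upper bound for \<open>total_variation E w + \<mu> * Nfun E w\<close> on the
    ball of radius \<open>M\<close>, attained at \<open>x\<close>.\<close>
  define K where "K = \<mu> * (2 * volume E * M)"
  have K: "total_variation E w + \<mu> * Nfun E w \<le> K" if "infnorm w \<le> M" for w
  proof -
    have "\<mu> * (2 * volume E * infnorm w) \<le> K"
      unfolding K_def using that pos vol by (intro mult_left_mono) auto
    then show ?thesis using bound[of w] by (simp add: right_diff_distrib)
  qed
  \<comment> \<open>Here \<open>j\<close> in \<open>D0 x\<close> matters: \<open>x $ j\<close> lies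
    strictly between the values \<open>- M\<close> and \<open>M\<close> at \<open>i\<close>.\<close>
  have "total_variation E x < (1 - u) * total_variation E y + u * total_variation E z"
    unfolding x_eq
    by (rule total_variation_strictly_convex_across[OF edge u])
      (use xj ij(2) in \<open>auto simp: y_def z_def\<close>)
  moreover have "\<mu> * Nfun E x \<le> \<mu> * ((1 - u) * Nfun E y + u * Nfun E z)"
    unfolding x_eq using u pos
    by (intro mult_left_mono convex_onD[OF convex_on_Nfun]) auto
  ultimately have "total_variation E x + \<mu> * Nfun E x
      < (1 - u) * (total_variation E y + \<mu> * Nfun E y) + u * (total_variation E z + \<mu> * Nfun E z)"
    by (simp add: algebra_simps)
  also have "\<dots> \<le> (1 - u) * K + u * K"
    using u K \<open>infnorm y \<le> M\<close> \<open>infnorm z \<le> M\<close> by (intro add_mono mult_left_mono) auto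
  \<comment> \<open>The eigenpair identity says that \<open>x\<close> attains \<open>K\<close>,
    which closes the strict cycle.\<close>
  also have "\<dots> = total_variation E x + \<mu> * Nfun E x"
    using AC_eigenpair_total_variation[OF assms(4)] by (simp add: K_def M_def algebra_simps)
  finally show False by simp
qed

end
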